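(* Let $m,n\ge 3$ be integers. Then $$ {\rm rn}(P_m\Box K_{1,n})=\begin{cases}\frac12\left[m^2(n+1)+2m+n-1\right], & \text{if } m \text{ is odd},\\[2pt] \frac12\left[m^2(n+1)+2(m-1)\right], & \text{if } m \text{ is even}.\end{cases} $$
   Context: $P_m$ is the path on $m$ vertices, $K_{1,n}$ is the star with one center adjacent to $n$ leaves, and $\Box$ denotes the Cartesian product of graphs. A radio labeling of a connected graph $G$ is a map $f:V(G)\to\mathbb{Z}_{\ge 0}$ with $|f(u)-f(v)|\geq {\rm diam}(G)+1-d(u,v)$ for all distinct vertices $u,v$, where $d$ is the graph distance; its span is $\max f-\min f$, and the radio number ${\rm rn}(G)$ is the minimum span of a radio labeling of $G$. *)

theory Defs
  imports "Graph_Theory.Graph_Theory"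
begin

text \<open>
  Following the Graph_Theory library, an undirected simple graph is a symmetric
  loop-free digraph without parallel arcs (locale \<^locale>\<open>pair_graph\<close>): each edge
  is represented by its two orientations.
\<close>

definition path_graph :: "nat \<Rightarrow> nat pair_pre_digraph" where
  "path_graph m = \<lparr> pverts = {1..m},
     parcs = {(i, j). i \<in> {1..m} \<and> j \<in> {1..m} \<and> (j = i + 1 \<or> i = j + 1)} \<rparr>"

text \<open>The centre of the star is 0 and its leaves are 1, \<dots>, n.\<close>

definition star_graph :: "nat \<Rightarrow> nat pair_pre_digraph" where
  "star_graph n = \<lparr> pverts = {0..n}, parcs = {0} \<times> {1..n} \<union> {1..n} \<times> {0} \<rparr>"

definition box_product ::
    "'a pair_pre_digraph \<Rightarrow> 'b pair_pre_digraph \<Rightarrow> ('a \<times> 'b) pair_pre_digraph" where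
  "box_product G H = \<lparr> pverts = pverts G \<times> pverts H,
     parcs = {((a, b), (a', b')).
       (a = a' \<and> a \<in> pverts G \<and> (b, b') \<in> parcs H) \<or>
       (b = b' \<and> b \<in> pverts H \<and> (a, a') \<in> parcs G)} \<rparr>"

text \<open>
  The constant \<open>wf_digraph.\<mu>\<close> is the weighted distance of the library, with values in
  \<^typ>\<open>ereal\<close>. With unit weights it is the graph distance, and it is finite for
  vertices of a connected graph, so nothing is lost by passing to \<^typ>\<open>real\<close>
  (see \<open>graph_dist_eq_Least\<close> below).
\<close>

definition graph_dist :: "('a, 'b) pre_digraph \<Rightarrow> 'a \<Rightarrow> 'a \<Rightarrow> real" where
  "graph_dist G u v = real_of_ereal (wf_digraph.\<mu> G (\<lambda>_. 1) u v)"

definition diam :: "('a, 'b) pre_digraph \<Rightarrow> real" where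
  "diam G = Max {graph_dist G u v | u v. u \<in> verts G \<and> v \<in> verts G}"

text \<open>
  The following notions are meant for finite connected graphs. A labeling is a total
  function, of which only the values on the vertex set matter.
\<close>

definition radio_labeling :: "('a, 'b) pre_digraph \<Rightarrow> ('a \<Rightarrow> nat) \<Rightarrow> bool" where
  "radio_labeling G f \<longleftrightarrow> (\<forall>u \<in> verts G. \<forall>v \<in> verts G. u \<noteq> v \<longrightarrow>
     \<bar>real (f u) - real (f v)\<bar> \<ge> diam G + 1 - graph_dist G u v)"

definition label_span :: "('a, 'b) pre_digraph \<Rightarrow> ('a \<Rightarrow> nat) \<Rightarrow> nat" where
  "label_span G f = Max (f ` verts G) - Min (f ` verts G)"

definition radio_number :: "('a, 'b) pre_digraph \<Rightarrow> nat" where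
  "radio_number G = (LEAST s. \<exists>f. radio_labeling G f \<and> label_span G f = s)"

lemma graph_dist_eq_Least:
  assumes "fin_digraph G" and "u \<rightarrow>\<^sup>*\<^bsub>G\<^esub> v"
  shows "graph_dist G u v = real (LEAST k. \<exists>p. pre_digraph.awalk G u p v \<and> length p = k)"
proof -
  interpret fin_digraph G by fact
  have cost: "awalk_cost (\<lambda>_. 1) p = real (length p)" for p
    by (induction p) auto
  obtain p where p: "apath u p v" "\<mu> (\<lambda>_. 1) u v = awalk_cost (\<lambda>_. 1) p"
    using no_neg_cyc_reach_imp_path[OF assms(2), of "\<lambda>_. 1"] by (auto simp: cost)
  have "(LEAST k. \<exists>p. awalk u p v \<and> length p = k) = length p"
  proof (rule Least_equality)
    show "\<exists>q. awalk u q v \<and> length q = length p"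
      using p(1) by (auto simp: apath_def)
    fix k assume "\<exists>q. awalk u q v \<and> length q = k"
    then show "length p \<le> k"
      using min_cost_le_walk_cost[of u _ v "\<lambda>_. 1"] p(2) by (auto simp: cost)
  qed
  then show ?thesis by (simp add: graph_dist_def p(2) cost)
qed

lemma pair_graph_path_graph: "pair_graph (path_graph m)"
proof
  show "finite (parcs (path_graph m))"
    by (rule finite_subset[of _ "{1..m} \<times> {1..m}"]) (auto simp: path_graph_def)
qed (auto simp: path_graph_def symmetric_def sym_def)

lemma pair_graph_star_graph: "pair_graph (star_graph n)"
  by standard (auto simp: star_graph_def symmetric_def sym_def)

lemma star_graph_complete_bipartite: "K\<^bsub>1,n\<^esub> (with_proj (star_graph n))"
proof -
  interpret pair_graph "star_graph n" by (rule pair_graph_star_graph)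
  have "graph (with_proj (star_graph n))" by unfold_locales
  then show ?thesis
    unfolding complete_bipartite_digraph_def
    by (intro conjI exI[of _ "{0}"] exI[of _ "{1..n}"]) (auto simp: star_graph_def)
qed

lemma pair_graph_box_product:
  assumes "pair_graph G" and "pair_graph H"
  shows "pair_graph (box_product G H)"
proof -
  interpret G: pair_graph G by fact
  interpret H: pair_graph H by fact
  have sub: "parcs (box_product G H) \<subseteq> (pverts G \<times> pverts H) \<times> (pverts G \<times> pverts H)"
    using G.arc_fst_in_verts G.arc_snd_in_verts H.arc_fst_in_verts H.arc_snd_in_verts
    by (fastforce simp: box_product_def)
  have symG: "sym (parcs G)" and symH: "sym (parcs H)"
    using G.pair_sym_arcs H.pair_sym_arcs by (auto simp: symmetric_def)
  show ?thesis
  proof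
    show "finite (pverts (box_product G H))"
      using G.pair_finite_verts H.pair_finite_verts by (simp add: box_product_def)
    then show "finite (parcs (box_product G H))"
      using finite_subset[OF sub] by (simp add: box_product_def)
    show "symmetric (with_proj (box_product G H))"
      using symG symH by (auto simp: symmetric_def sym_def box_product_def)
    fix e assume e: "e \<in> parcs (box_product G H)"
    show "fst e \<in> pverts (box_product G H)" "snd e \<in> pverts (box_product G H)"
      using subsetD[OF sub e] unfolding mem_Times_iff by (simp_all add: box_product_def mem_Times_iff)
    show "fst e \<noteq> snd e"
      using e G.pair_no_loops H.pair_no_loops by (fastforce simp: box_product_def)
  qed
qed

lemma strongly_connected_path_graph:
  assumes "m \<ge> 1"
  shows "strongly_connected (with_proj (path_graph m))"
proof -
  interpret pair_graph "path_graph m" by (rule pair_graph_path_graph)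
  have up: "1 \<rightarrow>\<^sup>*\<^bsub>with_proj (path_graph m)\<^esub> i" if "1 \<le> i" "i \<le> m" for i
    using that
  proof (induction i rule: dec_induct)
    case base
    then show ?case by - (rule reachable_refl, simp add: path_graph_def)
  next
    case (step k)
    have "1 \<rightarrow>\<^sup>*\<^bsub>with_proj (path_graph m)\<^esub> k"
      using step.prems by (intro step.IH) simp
    moreover have "(k, Suc k) \<in> parcs (path_graph m)"
      using step by (auto simp: path_graph_def)
    ultimately show ?case by (simp add: reachable_adj_trans)
  qed
  show ?thesis
  proof (rule strongly_connectedI)
    show "verts (with_proj (path_graph m)) \<noteq> {}"
      using assms by (simp add: path_graph_def)
    fix u v assume "u \<in> verts (with_proj (path_graph m))" "v \<in> verts (with_proj (path_graph m))"
    then show "u \<rightarrow>\<^sup>*\<^bsub>with_proj (path_graph m)\<^esub> v"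
      by - (rule reachable_trans[OF symmetric_reachable[OF pair_sym_arcs up[of u]] up[of v]],
        simp_all add: path_graph_def)
  qed
qed

lemma strongly_connected_star_graph: "strongly_connected (with_proj (star_graph n))"
proof -
  interpret pair_graph "star_graph n" by (rule pair_graph_star_graph)
  have up: "0 \<rightarrow>\<^sup>*\<^bsub>with_proj (star_graph n)\<^esub> i" if "i \<le> n" for i
  proof (cases "i = 0")
    case True
    have "0 \<rightarrow>\<^sup>*\<^bsub>with_proj (star_graph n)\<^esub> 0"
      by (rule reachable_refl) (simp add: star_graph_def)
    with True show ?thesis by simp
  next
    case False
    then have "(0, i) \<in> parcs (star_graph n)"
      using that by (auto simp: star_graph_def)
    then show ?thesis using reachable_adjI by auto
  qed
  show ?thesis
  proof (rule strongly_connectedI)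
    show "verts (with_proj (star_graph n)) \<noteq> {}"
      by (simp add: star_graph_def)
    fix u v assume "u \<in> verts (with_proj (star_graph n))" "v \<in> verts (with_proj (star_graph n))"
    then show "u \<rightarrow>\<^sup>*\<^bsub>with_proj (star_graph n)\<^esub> v"
      by - (rule reachable_trans[OF symmetric_reachable[OF pair_sym_arcs up[of u]] up[of v]],
        simp_all add: star_graph_def)
  qed
qed

lemma strongly_connected_box_product:
  assumes "pair_graph G" "pair_graph H"
    and "strongly_connected (with_proj G)" "strongly_connected (with_proj H)"
  shows "strongly_connected (with_proj (box_product G H))"
proof -
  interpret P: pair_graph "box_product G H"
    using assms(1,2) by (rule pair_graph_box_product)
  have left: "(a, b) \<rightarrow>\<^sup>*\<^bsub>with_proj (box_product G H)\<^esub> (a', b)"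
    if "a \<rightarrow>\<^sup>*\<^bsub>with_proj G\<^esub> a'" "b \<in> pverts H" for a a' b
    using that(1) unfolding reachable_def
    by (induction rule: rtrancl_on_induct)
      (use that(2) in \<open>auto simp: box_product_def intro: rtrancl_on_into_rtrancl_on\<close>)
  have right: "(a, b) \<rightarrow>\<^sup>*\<^bsub>with_proj (box_product G H)\<^esub> (a, b')"
    if "b \<rightarrow>\<^sup>*\<^bsub>with_proj H\<^esub> b'" "a \<in> pverts G" for a b b'
    using that(1) unfolding reachable_def
    by (induction rule: rtrancl_on_induct)
      (use that(2) in \<open>auto simp: box_product_def intro: rtrancl_on_into_rtrancl_on\<close>)
  show ?thesis
  proof (rule strongly_connectedI)
    show "verts (with_proj (box_product G H)) \<noteq> {}"
      using assms(3,4) by (auto simp: box_product_def strongly_connected_def)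
    fix u v
    assume "u \<in> verts (with_proj (box_product G H))" "v \<in> verts (with_proj (box_product G H))"
    then obtain a b a' b' where uv: "u = (a, b)" "v = (a', b')"
      "a \<in> pverts G" "b \<in> pverts H" "a' \<in> pverts G" "b' \<in> pverts H"
      by (auto simp: box_product_def)
    have "(a, b) \<rightarrow>\<^sup>*\<^bsub>with_proj (box_product G H)\<^esub> (a', b)"
      using left uv assms(3) by (auto simp: strongly_connected_def)
    moreover have "(a', b) \<rightarrow>\<^sup>*\<^bsub>with_proj (box_product G H)\<^esub> (a', b')"
      using right uv assms(4) by (auto simp: strongly_connected_def)
    ultimately show "u \<rightarrow>\<^sup>*\<^bsub>with_proj (box_product G H)\<^esub> v"
      unfolding uv by (rule P.reachable_trans)
  qed
qed

end

theory Submission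
  imports Defs
begin

text \<open>
  Write \<open>K = diam + 1 = m + 2\<close> and let the level of a vertex be its distance to the middle of the
  product (the middle row for odd \<open>m\<close>, the two middle rows for even \<open>m\<close>, always at the centre of
  the star). Distances satisfy \<open>D u v \<le> L u + L v + s\<close> with \<open>s = 0\<close> for odd and \<open>s = 1\<close> for
  even \<open>m\<close>. Listing the \<open>N\<close> vertices by increasing label and summing the radio condition over
  consecutive pairs bounds the span from below by \<open>(N - 1) (K - s) - 2 \<Sum>L\<close> plus the levels of the
  first and the last vertex. The bound is attained by an ordering in which every consecutive pair has
  \<open>D u v = L u + L v + s\<close> and for which the labels accumulated greedily satisfy the radio condition
  also for pairs that are two or three steps apart; pairs further apart are then harmless.
  For even \<open>m = 2 h\<close> the ordering alternates between rows \<open>j\<close> and \<open>j + h\<close>, for \<open>j\<close> from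
  \<open>h\<close> down to 1. For odd \<open>m = 2 h + 1\<close> it first cycles through rows \<open>h + 1\<close>, 1 and \<open>2 h + 1\<close>,
  and then alternates between rows \<open>j\<close> and \<open>j + h\<close> for \<open>j\<close> from \<open>h\<close> down to 2.
\<close>

section \<open>Radio chains and the span formula they yield\<close>

text \<open>
  If \<open>a, b, c\<close> are consecutive and each step of the labeling is \<open>K\<close> minus the distance, then the first
  conjunct of \<open>gap2\<close> is the radio condition for \<open>a\<close> and \<open>c\<close>. The second one makes any two consecutive
  steps add up to at least \<open>K / 2\<close>, so that four steps always suffice. Likewise \<open>gap3\<close> is the radio
  condition for \<open>a\<close> and \<open>d\<close>.
\<close>

definition gap2 :: "('v \<Rightarrow> 'v \<Rightarrow> int) \<Rightarrow> int \<Rightarrow> 'v \<Rightarrow> 'v \<Rightarrow> 'v \<Rightarrow> bool" where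
  "gap2 D K a b c \<longleftrightarrow> D a b + D b c \<le> K + D a c \<and> 2 * (D a b + D b c) \<le> 3 * K"

definition gap3 :: "('v \<Rightarrow> 'v \<Rightarrow> int) \<Rightarrow> int \<Rightarrow> 'v \<Rightarrow> 'v \<Rightarrow> 'v \<Rightarrow> 'v \<Rightarrow> bool" where
  "gap3 D K a b c d \<longleftrightarrow> D a b + D b c + D c d \<le> 2 * K + D a d"

text \<open>Recursion over windows lets explicit prefixes be checked by unfolding and lets pairs be
  prepended to a known chain.\<close>

fun radio_chain :: "('v \<Rightarrow> 'v \<Rightarrow> int) \<Rightarrow> ('v \<Rightarrow> int) \<Rightarrow> int \<Rightarrow> int \<Rightarrow> 'v list \<Rightarrow> bool" where
  "radio_chain D L K s (a # b # c # d # us) \<longleftrightarrow> D a b = L a + L b + s \<and> gap2 D K a b c \<and>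
     gap3 D K a b c d \<and> radio_chain D L K s (b # c # d # us)"
| "radio_chain D L K s [a, b, c] \<longleftrightarrow> D a b = L a + L b + s \<and> D b c = L b + L c + s \<and> gap2 D K a b c"
| "radio_chain D L K s [a, b] \<longleftrightarrow> D a b = L a + L b + s"
| "radio_chain D L K s [a] \<longleftrightarrow> True"
| "radio_chain D L K s [] \<longleftrightarrow> True"

lemma radio_chain_nth:
  assumes "radio_chain D L K s us"
  shows "i + 1 < length us \<Longrightarrow> D (us ! i) (us ! (i + 1)) = L (us ! i) + L (us ! (i + 1)) + s"
    and "i + 2 < length us \<Longrightarrow> gap2 D K (us ! i) (us ! (i + 1)) (us ! (i + 2))"
    and "i + 3 < length us \<Longrightarrow> gap3 D K (us ! i) (us ! (i + 1)) (us ! (i + 2)) (us ! (i + 3))"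
  using assms
proof (induction D L K s us arbitrary: i rule: radio_chain.induct)
  case (1 D L K s a b c d us)
  { case 1 with "1.IH"(1)[of "i - 1"] show ?case by (cases i) auto }
  { case 2 with "1.IH"(2)[of "i - 1"] show ?case by (cases i) auto }
  { case 3 with "1.IH"(3)[of "i - 1"] show ?case by (cases i) (auto simp: numeral_3_eq_3) }
next
  case (2 D L K s a b c)
  { case 1 then show ?case by (auto simp: less_Suc_eq) }
  { case 2 then show ?case by (auto simp: less_Suc_eq) }
  { case 3 then show ?case by (auto simp: less_Suc_eq) }
qed auto

text \<open>A consecutive pair \<open>u\<close>, \<open>v\<close> forces a label increase of at
  least \<open>K - D u v \<ge> (K - s) - L u - L v\<close>. Summed over the list, inner levels count
  twice and those of the two ends once.\<close>

lemma sorted_labels_difference_ge: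
  fixes f :: "'v \<Rightarrow> nat"
  assumes "distinct vs" "sorted (map f vs)" "vs \<noteq> []"
    and "\<And>u v. u \<in> set vs \<Longrightarrow> v \<in> set vs \<Longrightarrow> u \<noteq> v \<Longrightarrow> K - D u v \<le> \<bar>int (f u) - int (f v)\<bar>"
    and "\<And>u v. u \<in> set vs \<Longrightarrow> v \<in> set vs \<Longrightarrow> u \<noteq> v \<Longrightarrow> D u v \<le> L u + L v + s"
  shows "(int (length vs) - 1) * (K - s) - 2 * (\<Sum>v\<leftarrow>vs. L v) + L (hd vs) + L (last vs)
    \<le> int (f (last vs)) - int (f (hd vs))"
  using assms
proof (induction vs rule: induct_list012)
  case (3 u v vs)
  have "K - D u v \<le> int (f v) - int (f u)" "D u v \<le> L u + L v + s"
    using "3.prems"(1,2) "3.prems"(4,5)[of u v] by auto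
  moreover have "(int (length (v # vs)) - 1) * (K - s) - 2 * (\<Sum>v\<leftarrow>v # vs. L v) + L (hd (v # vs))
      + L (last (v # vs)) \<le> int (f (last (v # vs))) - int (f (hd (v # vs)))"
    using "3.prems" by (intro "3.IH"(2)) auto
  ultimately show ?case by (simp add: algebra_simps)
qed auto

text \<open>Lower bound: sort the vertices by label and apply
  \<open>sorted_labels_difference_ge\<close>; by \<open>ends\<close>, no two distinct end vertices
  give smaller end terms than those of \<open>us\<close>. Upper bound: let labels grow by exactly
  \<open>K - D\<close> along \<open>us\<close>; the edge equalities of the chain then turn the
  estimates of the lower bound into equalities.\<close>

lemma radio_number_eqI:
  fixes D :: "'v \<Rightarrow> 'v \<Rightarrow> int"
  assumes us: "set us = verts G" "distinct us" "2 \<le> length us"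
    and dist: "\<And>u v. u \<in> verts G \<Longrightarrow> v \<in> verts G \<Longrightarrow> graph_dist G u v = D u v"
    and diam: "diam G = K - 1"
    and D_sym: "\<And>u v. D u v = D v u"
    and D_nonneg: "\<And>u v. 0 \<le> D u v"
    and D_less: "\<And>u v. u \<in> verts G \<Longrightarrow> v \<in> verts G \<Longrightarrow> D u v < K"
    and D_le: "\<And>u v. u \<in> verts G \<Longrightarrow> v \<in> verts G \<Longrightarrow> D u v \<le> L u + L v + s"
    and ends: "\<And>u v. u \<in> verts G \<Longrightarrow> v \<in> verts G \<Longrightarrow> u \<noteq> v \<Longrightarrow> L (hd us) + L (last us) \<le> L u + L v"
    and chain: "radio_chain D L K s us"
  shows "int (radio_number G) =
    (int (length us) - 1) * (K - s) - 2 * (\<Sum>v\<in>verts G. L v) + L (hd us) + L (last us)"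
    (is "_ = ?S")
proof -
  define N where "N = length us"
  have fin: "finite (verts G)" using us(1) by (metis List.finite_set)
  have sum_us: "(\<Sum>v\<leftarrow>us. L v) = (\<Sum>v\<in>verts G. L v)"
    using us by (simp add: sum_list_distinct_conv_sum_set)
  have usne: "us \<noteq> []" using us(3) by auto
  have lower: "?S \<le> int (label_span G f)" if f: "radio_labeling G f" for f
  proof -
    define vs where "vs = sort_key f us"
    have vs: "set vs = verts G" "distinct vs" "length vs = length us" "sorted (map f vs)"
      using us by (auto simp: vs_def)
    have ne: "vs \<noteq> []" using vs(3) us(3) by auto
    have neq: "hd vs \<noteq> last vs"
      using vs(2,3) us(3) by (cases vs; cases "tl vs") auto
    have radio: "K - D u v \<le> \<bar>int (f u) - int (f v)\<bar>" if "u \<in> verts G" "v \<in> verts G" "u \<noteq> v" for u v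
    proof -
      have "diam G + 1 - graph_dist G u v \<le> \<bar>real (f u) - real (f v)\<bar>"
        using f that by (simp add: radio_labeling_def)
      then have "real_of_int (K - D u v) \<le> real_of_int \<bar>int (f u) - int (f v)\<bar>"
        using dist[OF that(1,2)] diam by simp
      then show ?thesis by linarith
    qed
    have "?S \<le> (int (length vs) - 1) * (K - s) - 2 * (\<Sum>v\<leftarrow>vs. L v) + L (hd vs) + L (last vs)"
      using ends[OF _ _ neq] hd_in_set[OF ne] last_in_set[OF ne] vs
      by (simp add: sum_list_distinct_conv_sum_set)
    also have "\<dots> \<le> int (f (last vs)) - int (f (hd vs))"
      using vs ne radio D_le by (intro sorted_labels_difference_ge) auto
    also have "\<dots> \<le> int (label_span G f)"
    proof -
      have "f (last vs) \<le> Max (f ` verts G)" "Min (f ` verts G) \<le> f (hd vs)"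
        using fin ne vs(1) by (auto intro!: Max_ge Min_le)
      then show ?thesis unfolding label_span_def by linarith
    qed
    finally show ?thesis .
  qed
  define p where "p i = (\<Sum>j<i. K - D (us ! j) (us ! (j + 1)))" for i
  \<comment> \<open>Indexing into \<open>us\<close> is injective, so its inverse is the position of
    a vertex; \<open>nat\<close> loses nothing because \<open>p\<close> is nonnegative on
    positions.\<close>
  define f where "f v = nat (p (inv_into {..<N} ((!) us) v))" for v
  have inj: "inj_on ((!) us) {..<N}"
    using us(2) by (intro inj_on_nth) (auto simp: N_def)
  have in_V: "us ! i \<in> verts G" if "i < N" for i
    using that us(1) nth_mem[of i us] by (simp add: N_def)
  \<comment> \<open>Distances are integers below \<open>K\<close>, so the labels strictly increase
    along \<open>us\<close>.\<close>
  have p_step: "1 \<le> p (Suc i) - p i" if "Suc i < N" for i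
    using D_less[OF in_V[OF Suc_lessD[OF that]] in_V[OF that]] by (simp add: p_def)
  have mono: "p i \<le> p j" if "i \<le> j" "j < N" for i j
    using that
  proof (induction j rule: dec_induct)
    case (step j)
    then show ?case using p_step[of j] by simp
  qed simp
  have p0: "p 0 = 0" by (simp add: p_def)
  have p_nonneg: "0 \<le> p i" if "i < N" for i using mono[of 0 i] that p0 by simp
  have f_us: "int (f (us ! i)) = p i" if "i < N" for i
    using that inj p_nonneg by (simp add: f_def inv_into_f_f)
  have gap: "K - D (us ! i) (us ! j) \<le> p j - p i" if ij: "i < j" "j < N" for i j
  proof -
    consider "j = i + 1" | "j = i + 2" | "j = i + 3" | "i + 4 \<le> j" using ij(1) by linarith
    then show ?thesis
    proof cases
      case 1 then show ?thesis by (simp add: p_def)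
    next
      case 2
      then show ?thesis using radio_chain_nth(2)[OF chain, of i] ij(2)
        by (simp add: p_def gap2_def N_def)
    next
      case 3
      then show ?thesis using radio_chain_nth(3)[OF chain, of i] ij(2)
        by (simp add: p_def gap3_def N_def numeral_3_eq_3)
    next
      case 4
      \<comment> \<open>By the second conjunct of \<open>gap2\<close>, the two steps from
        \<open>i\<close> and the two from \<open>i + 2\<close> each gain at least
        \<open>K / 2\<close>.\<close>
      have "2 * K \<le> 2 * (p (i + 4) - p i)"
        using radio_chain_nth(2)[OF chain, of i] radio_chain_nth(2)[OF chain, of "i + 2"] ij(2) 4
        by (simp add: p_def gap2_def N_def numeral_eq_Suc)
      then have "K \<le> p (i + 4) - p i" by simp
      also have "\<dots> \<le> p j - p i" using mono[OF 4 ij(2)] by simp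
      finally show ?thesis using D_nonneg[of "us ! i" "us ! j"] by simp
    qed
  qed
  have f_radio: "radio_labeling G f"
    unfolding radio_labeling_def
  proof (intro ballI impI)
    fix u v assume uv: "u \<in> verts G" "v \<in> verts G" "u \<noteq> v"
    obtain i j where ij: "i < N" "j < N" "u = us ! i" "v = us ! j"
      using uv us(1) unfolding N_def by (metis in_set_conv_nth)
    have "K - D u v \<le> \<bar>int (f u) - int (f v)\<bar>"
    proof (cases i j rule: linorder_cases)
      case less
      then show ?thesis using gap[of i j] ij f_us[of i] f_us[of j] by simp
    next
      case equal
      then show ?thesis using ij uv(3) by simp
    next
      case greater
      then show ?thesis using gap[of j i] ij f_us[of i] f_us[of j] D_sym[of u v] by simp
    qed
    then have "real_of_int (K - D u v) \<le> real_of_int \<bar>int (f u) - int (f v)\<bar>" by linarith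
    then show "diam G + 1 - graph_dist G u v \<le> \<bar>real (f u) - real (f v)\<bar>"
      using uv dist[of u v] diam by simp
  qed
  have p_eq: "p i = int i * (K - s) - 2 * (\<Sum>j\<le>i. L (us ! j)) + L (us ! 0) + L (us ! i)" if "i < N" for i
    using that
  proof (induction i)
    case (Suc i)
    then show ?case using radio_chain_nth(1)[OF chain, of i]
      by (simp add: p_def N_def algebra_simps)
  qed (simp add: p_def)
  have "p (N - 1) = ?S"
  proof -
    have "{..N - 1} = {0..<N}" using us(3) by (auto simp: N_def)
    then have "(\<Sum>j\<le>N - 1. L (us ! j)) = (\<Sum>v\<leftarrow>us. L v)"
      by (simp add: sum_list_sum_nth N_def)
    then show ?thesis
      using p_eq[of "N - 1"] us(3) sum_us usne by (simp add: N_def hd_conv_nth last_conv_nth of_nat_diff)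
  qed
  moreover have "int (label_span G f) = p (N - 1)"
  proof -
    have im: "f ` verts G = (\<lambda>i. f (us ! i)) ` {..<N}"
      unfolding us(1)[symmetric] N_def set_conv_nth by auto
    have N: "0 < N" using usne by (simp add: N_def)
    have "Max (f ` verts G) = f (us ! (N - 1))"
    proof (rule Max_eqI)
      fix y assume "y \<in> f ` verts G"
      then obtain i where i: "i < N" "y = f (us ! i)" by (auto simp: im)
      then show "y \<le> f (us ! (N - 1))"
        using mono[of i "N - 1"] f_us[of i] f_us[of "N - 1"] N by linarith
    qed (use fin in_V[of "N - 1"] N in auto)
    moreover have "Min (f ` verts G) = f (us ! 0)"
    proof (rule Min_eqI)
      fix y assume "y \<in> f ` verts G"
      then obtain i where i: "i < N" "y = f (us ! i)" by (auto simp: im)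
      then show "f (us ! 0) \<le> y"
        using f_us[of i] f_us[of 0] p_nonneg[of i] p0 by simp
    qed (use fin in_V[of 0] N in auto)
    ultimately show ?thesis
      using f_us[of "N - 1"] f_us[of 0] p0 N by (simp add: label_span_def)
  qed
  ultimately have span_f: "int (label_span G f) = ?S" by simp
  have "\<exists>g. radio_labeling G g \<and> label_span G g = radio_number G"
    unfolding radio_number_def by (rule LeastI_ex) (use f_radio in blast)
  then obtain g where "radio_labeling G g" "label_span G g = radio_number G" by blast
  moreover have "radio_number G \<le> label_span G f"
    unfolding radio_number_def by (rule Least_le) (use f_radio in blast)
  ultimately show ?thesis using lower[of g] span_f by linarith
qed

section \<open>Distances and diameter of the product\<close>

text \<open>A function that drops by at most one along each arc bounds every walk to
  \<open>v\<close> from below, and a descending arc wherever it is positive yields a walk of exactly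
  that length. A distance formula is thus verified arc by arc.\<close>

lemma graph_dist_eqI:
  fixes \<delta> :: "'a \<Rightarrow> nat"
  assumes "fin_digraph G"
    and v: "v \<in> verts G" "\<delta> v = 0"
    and arc: "\<And>e. e \<in> arcs G \<Longrightarrow> \<delta> (tail G e) \<le> Suc (\<delta> (head G e))"
    and zero: "\<And>u. u \<in> verts G \<Longrightarrow> \<delta> u = 0 \<Longrightarrow> u = v"
    and descent: "\<And>u k. u \<in> verts G \<Longrightarrow> \<delta> u = Suc k \<Longrightarrow>
      \<exists>e\<in>arcs G. tail G e = u \<and> \<delta> (head G e) = k"
    and u: "u \<in> verts G"
  shows "graph_dist G u v = real (\<delta> u)"
proof -
  interpret fin_digraph G by fact
  have lower: "\<delta> w \<le> length p" if "awalk w p v" for w p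
    using that
  proof (induction p arbitrary: w)
    case Nil
    then show ?case using v by (auto simp: awalk_Nil_iff)
  next
    case (Cons e p)
    then have "e \<in> arcs G" "w = tail G e" "awalk (head G e) p v" by (auto simp: awalk_Cons_iff)
    then show ?case using arc[of e] Cons.IH[of "head G e"] by simp
  qed
  have upper: "\<exists>p. awalk w p v \<and> length p = k" if "w \<in> verts G" "\<delta> w = k" for w k
    using that
  proof (induction k arbitrary: w)
    case 0
    then show ?case using zero v(1) by (auto simp: awalk_Nil_iff)
  next
    case (Suc k)
    then obtain e where e: "e \<in> arcs G" "tail G e = w" "\<delta> (head G e) = k" using descent by blast
    then obtain p where "awalk (head G e) p v" "length p = k" using Suc.IH[of "head G e"] by auto
    then show ?case using e by (intro exI[of _ "e # p"]) (auto simp: awalk_Cons_iff)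
  qed
  have "(LEAST k. \<exists>p. awalk u p v \<and> length p = k) = \<delta> u"
    using upper[OF u] lower by (intro Least_equality) auto
  moreover have "u \<rightarrow>\<^sup>*\<^bsub>G\<^esub> v" using upper[OF u] reachable_awalkI by blast
  ultimately show ?thesis by (simp add: graph_dist_eq_Least[OF assms(1)])
qed

definition star_dist :: "nat \<Rightarrow> nat \<Rightarrow> int" where
  "star_dist a b = (if a = b then 0 else if a = 0 \<or> b = 0 then 1 else 2)"

definition path_star_dist :: "nat \<times> nat \<Rightarrow> nat \<times> nat \<Rightarrow> int" where
  "path_star_dist u v = \<bar>int (fst u) - int (fst v)\<bar> + star_dist (snd u) (snd v)"

lemma path_star_dist_simp [simp]:
  "path_star_dist (i, a) (j, b) = \<bar>int i - int j\<bar> + star_dist a b"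
  by (simp add: path_star_dist_def)

lemma star_dist_nonneg [simp]: "0 \<le> star_dist a b"
  by (simp add: star_dist_def)

lemma star_dist_commute: "star_dist a b = star_dist b a"
  by (auto simp: star_dist_def)

lemma path_star_dist_nonneg: "0 \<le> path_star_dist u v"
  by (simp add: path_star_dist_def)

lemma path_star_dist_commute: "path_star_dist u v = path_star_dist v u"
  by (simp add: path_star_dist_def star_dist_commute abs_minus_commute)

lemma verts_path_box_star:
  "verts (with_proj (box_product (path_graph m) (star_graph n))) = {1..m} \<times> {0..n}"
  by (simp add: box_product_def path_graph_def star_graph_def)

lemma graph_dist_path_box_star:
  assumes "u \<in> {1..m} \<times> {0..n}" "v \<in> {1..m} \<times> {0..n}"
  shows "graph_dist (with_proj (box_product (path_graph m) (star_graph n))) u v = path_star_dist u v"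
proof -
  let ?G = "with_proj (box_product (path_graph m) (star_graph n))"
  interpret pair_graph "box_product (path_graph m) (star_graph n)"
    by (intro pair_graph_box_product pair_graph_path_graph pair_graph_star_graph)
  have arcs: "e \<in> arcs ?G \<longleftrightarrow> (\<exists>i a j b. e = ((i, a), (j, b)) \<and> i \<in> {1..m} \<and> j \<in> {1..m} \<and>
      a \<le> n \<and> b \<le> n \<and> (i = j \<and> a \<noteq> b \<and> (a = 0 \<or> b = 0) \<or> a = b \<and> (j = i + 1 \<or> i = j + 1)))" for e
    by (cases e) (auto simp: box_product_def path_graph_def star_graph_def)
  have "graph_dist ?G u v = real (nat (path_star_dist u v))"
  proof (rule graph_dist_eqI[where \<delta> = "\<lambda>w. nat (path_star_dist w v)"])
    show "fin_digraph ?G" by unfold_locales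
    show "v \<in> verts ?G" "u \<in> verts ?G" using assms unfolding verts_path_box_star by simp_all
    show "nat (path_star_dist v v) = 0" by (simp add: path_star_dist_def star_dist_def)
  next
    fix e assume "e \<in> arcs ?G"
    then show "nat (path_star_dist (tail ?G e) v) \<le> Suc (nat (path_star_dist (head ?G e) v))"
      unfolding arcs by (cases v) (auto simp: star_dist_def)
  next
    fix w assume "nat (path_star_dist w v) = 0"
    then show "w = v"
      by (cases w; cases v) (auto simp: star_dist_def split: if_splits)
  next
    fix w k assume w: "w \<in> verts ?G" "nat (path_star_dist w v) = Suc k"
    obtain i a j b where ij: "w = (i, a)" "v = (j, b)" by (cases w; cases v)
    have bounds: "i \<in> {1..m}" "a \<le> n" "j \<in> {1..m}" "b \<le> n"
      using w(1) assms(2) ij unfolding verts_path_box_star by auto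
    \<comment> \<open>The first step of a shortest walk to \<open>v\<close>: correct the row first,
      then go to the centre of the star, or from the centre directly to \<open>b\<close>.\<close>
    define x where "x = (if i < j then (i + 1, a) else if j < i then (i - 1, a)
      else if a = 0 then (i, b) else (i, 0))"
    have "(w, x) \<in> arcs ?G"
      using bounds w(2) unfolding arcs ij x_def by (auto simp: star_dist_def split: if_splits)
    moreover have "nat (path_star_dist x v) = k"
      using bounds w(2) unfolding ij x_def by (auto simp: star_dist_def split: if_splits)
    ultimately show "\<exists>e\<in>arcs ?G. tail ?G e = w \<and> nat (path_star_dist (head ?G e) v) = k"
      by (intro bexI[of _ "(w, x)"]) auto
  qed
  then show ?thesis using path_star_dist_nonneg[of u v] by simp
qed

lemma diam_path_box_star:
  assumes "1 \<le> m" "2 \<le> n"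
  shows "diam (with_proj (box_product (path_graph m) (star_graph n))) = real m + 1"
proof -
  let ?G = "with_proj (box_product (path_graph m) (star_graph n))"
  let ?V = "{1..m} \<times> {0..n}"
  have image2: "{f u v |u v. u \<in> A \<and> v \<in> A} = (\<lambda>(u, v). f u v) ` (A \<times> A)"
    for f :: "nat \<times> nat \<Rightarrow> nat \<times> nat \<Rightarrow> real" and A
    by force
  have "{graph_dist ?G u v |u v. u \<in> verts ?G \<and> v \<in> verts ?G} =
      (\<lambda>(u, v). graph_dist ?G u v) ` (?V \<times> ?V)"
    unfolding verts_path_box_star by (rule image2)
  also have "\<dots> = (\<lambda>(u, v). real_of_int (path_star_dist u v)) ` (?V \<times> ?V)"
    by (rule image_cong) (auto simp: graph_dist_path_box_star simp del: path_star_dist_simp)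
  finally show ?thesis
    unfolding diam_def
  proof (simp only:, intro Max_eqI)
    fix x assume "x \<in> (\<lambda>(u, v). real_of_int (path_star_dist u v)) ` (?V \<times> ?V)"
    then show "x \<le> real m + 1" by (auto simp: star_dist_def)
  next
    \<comment> \<open>The maximum is attained by two different leaves in the two end rows, which is
      where \<open>n\<close> must be at least 2.\<close>
    show "real m + 1 \<in> (\<lambda>(u, v). real_of_int (path_star_dist u v)) ` (?V \<times> ?V)"
      using assms by (intro image_eqI[of _ _ "((1, 1), (m, 2))"]) (auto simp: star_dist_def)
  qed simp
qed

section \<open>Zigzag orderings are radio chains\<close>

definition star_level :: "nat \<Rightarrow> int" where
  "star_level a = (if a = 0 then 0 else 1)"

text \<open>
  The rows \<open>e + t\<close> and \<open>e + t + h\<close> are visited alternately, in the orders \<open>i = 0, \<dots>, n\<close> and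
  \<open>y 0, \<dots>, y n\<close> of the star vertices; then \<open>t\<close> is decreased.
\<close>

function zigzag :: "nat \<Rightarrow> nat \<Rightarrow> (nat \<Rightarrow> nat) \<Rightarrow> nat \<Rightarrow> nat \<Rightarrow> nat \<Rightarrow> (nat \<times> nat) list" where
  "zigzag e h y n 0 i = []"
| "zigzag e h y n (Suc t) i = (e + Suc t, i) # (e + Suc t + h, y i) #
     (if i < n then zigzag e h y n (Suc t) (Suc i) else zigzag e h y n t 0)"
  by pat_completeness auto
termination by (relation "measures [\<lambda>(e, h, y, n, t, i). t, \<lambda>(e, h, y, n, t, i). n - i]") auto

lemma star_level_bounds: "0 \<le> star_level a" "star_level a \<le> 1"
  by (simp_all add: star_level_def)

lemma star_dist_le: "star_dist a b \<le> star_level a + star_level b"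
  by (simp add: star_level_def star_dist_def)

lemma star_dist_eq: "a \<noteq> b \<or> a = 0 \<Longrightarrow> star_dist a b = star_level a + star_level b"
  by (auto simp: star_level_def star_dist_def)

text \<open>For distinct \<open>a\<close> and \<open>c\<close> the star distance is the sum of their
  levels, so the detour through \<open>b\<close> exceeds it by at most 2. The summand 8 is twice the
  largest star contribution 4.\<close>

lemma gap2_path_star:
  assumes "a \<noteq> c" "\<bar>int i - int j\<bar> + \<bar>int j - int k\<bar> + 2 \<le> K + \<bar>int i - int k\<bar>"
    "2 * (\<bar>int i - int j\<bar> + \<bar>int j - int k\<bar>) + 8 \<le> 3 * K"
  shows "gap2 path_star_dist K (i, a) (j, b) (k, c)"
proof -
  have "star_dist a c = star_level a + star_level c" using assms(1) by (simp add: star_dist_eq)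
  moreover define x y z where "x = \<bar>int i - int j\<bar>" "y = \<bar>int j - int k\<bar>" "z = \<bar>int i - int k\<bar>"
  ultimately show ?thesis
    using assms(2,3) star_dist_le[of a b] star_dist_le[of b c]
      star_level_bounds[of a] star_level_bounds[of b] star_level_bounds[of c]
    unfolding gap2_def path_star_dist_simp x_y_z_def[symmetric] by (simp del: star_dist_nonneg)
qed

lemma gap3_path_star:
  assumes "\<bar>int i - int j\<bar> + \<bar>int j - int k\<bar> + \<bar>int k - int l\<bar> + 6 \<le> 2 * K + \<bar>int i - int l\<bar>"
  shows "gap3 path_star_dist K (i, a) (j, b) (k, c) (l, d)"
  using assms star_dist_le[of a b] star_dist_le[of b c] star_dist_le[of c d] star_dist_nonneg[of a d]
    star_level_bounds[of a] star_level_bounds[of b] star_level_bounds[of c] star_level_bounds[of d]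
  unfolding gap3_def path_star_dist_simp by linarith

text \<open>One zigzag step puts a pair in front. The new windows reach no further than the fifth
  vertex \<open>e\<close>, so only the head of \<open>us\<close> matters; if \<open>us\<close> is
  empty, \<open>e\<close> is a dummy.\<close>

lemma radio_chain_Cons2I:
  assumes "radio_chain D L K s (c # d # us)" "D a b = L a + L b + s" "D b c = L b + L c + s"
    "gap2 D K a b c" "gap2 D K b c d" "gap3 D K a b c d"
    and "us = [] \<or> hd us = e" "gap3 D K b c d e"
  shows "radio_chain D L K s (a # b # c # d # us)"
  using assms by (cases us) auto

text \<open>In a block the star coordinates read \<open>0, y 0, 1, y 1, ..., n, y n\<close>. The
  inequations make neighbours distinct, and injectivity separates \<open>y i\<close> from
  \<open>y (Suc i)\<close>; \<open>y n = 0\<close> lets blocks meet at the star centre, where equal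
  coordinates are harmless. The conditions on \<open>\<rho>\<close> make row moves of length
  \<open>h\<close> within a block and \<open>h + 1\<close> between blocks tight. Going from row
  \<open>j\<close> over \<open>j + h\<close> back to \<open>j\<close> costs \<open>2 * h\<close>
  plus the slack 2 of \<open>gap2_path_star\<close>, hence the bound on \<open>K\<close>.\<close>

lemma radio_chain_zigzag:
  assumes n: "1 \<le> n"
    and y: "\<And>i. i \<le> n \<Longrightarrow> y i \<noteq> i" "\<And>i. i < n \<Longrightarrow> y i \<noteq> Suc i" "y n = 0"
    and L: "\<And>i a. L (i, a) = \<rho> i + star_level a"
    and \<rho>: "\<And>j. e < j \<Longrightarrow> j \<le> h \<Longrightarrow> \<rho> j + \<rho> (j + h) + s = int h"
      "\<And>j. e < j \<Longrightarrow> j < h \<Longrightarrow> \<rho> j + \<rho> (Suc j + h) + s = int h + 1"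
    and K: "2 * int h + 2 \<le> K"
    and "e + t \<le> h" "i \<le> n" and inj: "inj_on y {..n}"
  shows "radio_chain path_star_dist L K s (zigzag e h y n t i)"
  using assms
proof (induction e h y n t i rule: zigzag.induct)
  case (1 e h y n i)
  show ?case by simp
next
  case (2 e h y n t i)
  define j where "j = e + Suc t"
  have j: "e < j" "j \<le> h" "e + Suc t = j" "Suc (e + t) = j" using "2.prems"(9) by (auto simp: j_def)
  have zz: "zigzag e h y n (Suc t) i = (j, i) # (j + h, y i) #
      (if i < n then zigzag e h y n (Suc t) (Suc i) else zigzag e h y n t 0)" for i
    by (simp add: j_def)
  have K: "2 * int h + 2 \<le> K" by (rule "2.prems"(8))
  have h: "1 \<le> h" using j by simp
  have edge: "path_star_dist (i, a) (k, b) = L (i, a) + L (k, b) + s"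
    if "a \<noteq> b \<or> a = 0" "\<bar>int i - int k\<bar> = \<rho> i + \<rho> k + s" for i a k b
    using that by (simp add: "2.prems"(5) star_dist_eq)
  have rj: "\<bar>int j - int (j + h)\<bar> = \<rho> j + \<rho> (j + h) + s" "\<bar>int (j + h) - int j\<bar> = \<rho> (j + h) + \<rho> j + s"
    using "2.prems"(6)[OF j(1,2)] by simp_all
  have IH: "radio_chain path_star_dist L K s
      (if i < n then zigzag e h y n (Suc t) (Suc i) else zigzag e h y n t 0)"
    using "2.IH" "2.prems" by auto
  have y_Suc: "y i \<noteq> y (Suc i)" if "i < n" for i
    using inj_onD[OF "2.prems"(11), of i "Suc i"] that by auto
  \<comment> \<open>The five vertices concerned lie in one block, or the list ends or the next block
    begins after two or four of them.\<close>
  consider "Suc i < n" | "Suc i = n" "t = 0" | t' where "Suc i = n" "t = Suc t'"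
    | "i = n" "t = 0" | t' where "i = n" "t = Suc t'"
    using "2.prems"(10) by (metis Suc_lessI le_eq_less_or_eq not0_implies_Suc)
  then show ?case
  proof cases
    case 1
    have y: "y i \<noteq> i" "y (Suc i) \<noteq> Suc i" "y i \<noteq> Suc i" "y (Suc i) \<noteq> Suc (Suc i)" "y i \<noteq> y (Suc i)"
      using "2.prems"(2,3) y_Suc[of i] 1 by auto
    define us where "us = (if Suc i < n then zigzag e h y n (Suc t) (Suc (Suc i)) else zigzag e h y n t 0)"
    have eq: "zigzag e h y n (Suc t) i = (j, i) # (j + h, y i) # (j, Suc i) # (j + h, y (Suc i)) # us"
      using 1 by (simp add: zz us_def del: zigzag.simps(2))
    have chain: "radio_chain path_star_dist L K s ((j, Suc i) # (j + h, y (Suc i)) # us)"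
      using IH 1 by (simp add: zz us_def del: zigzag.simps(2) path_star_dist_simp split: if_splits)
    have hd: "us = [] \<or> hd us = (j, Suc (Suc i))"
      using 1 y by (simp add: us_def zz del: zigzag.simps(2) split: if_splits)
    show ?thesis
      unfolding eq
      by (rule radio_chain_Cons2I[OF chain _ _ _ _ _ hd];
          intro edge gap2_path_star gap3_path_star rj; use y h K in simp)
  next
    case 2
    have i: "i < n" using 2 by simp
    have y: "y i \<noteq> i" "y i \<noteq> Suc i" "y (Suc i) = 0" "y i \<noteq> y (Suc i)"
      using "2.prems"(2,3,4) y_Suc[of i] 2 by auto
    define us where "us = zigzag e h y n t 0"
    have eq: "zigzag e h y n (Suc t) i = (j, i) # (j + h, y i) # (j, Suc i) # (j + h, y (Suc i)) # us"
      using 2(1) i by (simp add: zz us_def del: zigzag.simps(2))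
    have chain: "radio_chain path_star_dist L K s ((j, Suc i) # (j + h, y (Suc i)) # us)"
      using IH 2(1) i by (simp add: zz us_def del: zigzag.simps(2) path_star_dist_simp split: if_splits)
    \<comment> \<open>Here \<open>us\<close> is empty and \<open>(j, 0)\<close> is only a
      dummy.\<close>
    have hd: "us = [] \<or> hd us = (j, 0)"
      using 2 y by (simp add: us_def zz del: zigzag.simps(2) split: if_splits)
    show ?thesis
      unfolding eq
      by (rule radio_chain_Cons2I[OF chain _ _ _ _ _ hd];
          intro edge gap2_path_star gap3_path_star rj; use y h K in simp)
  next
    case (3 t')
    have i: "i < n" using 3 by simp
    have y: "y i \<noteq> i" "y i \<noteq> Suc i" "y (Suc i) = 0" "y i \<noteq> y (Suc i)" "y 0 \<noteq> 0"
      using "2.prems"(2,3,4) y_Suc[of i] 3 by auto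
    define k where "k = e + Suc t'"
    have k: "e < k" "k < h" "j = Suc k" "t = Suc t'" using 3 j by (auto simp: k_def)
    have zk: "zigzag e h y n (Suc t') i = (k, i) # (k + h, y i) #
        (if i < n then zigzag e h y n (Suc t') (Suc i) else zigzag e h y n t' 0)" for i
      by (simp add: k_def)
    have rk: "\<bar>int k - int (k + h)\<bar> = \<rho> k + \<rho> (k + h) + s" "\<bar>int (k + h) - int k\<bar> = \<rho> (k + h) + \<rho> k + s"
      "\<bar>int (j + h) - int k\<bar> = \<rho> (j + h) + \<rho> k + s"
      using "2.prems"(6)[of k] "2.prems"(7)[of k] k by simp_all
    define us where "us = zigzag e h y n t 0"
    have eq: "zigzag e h y n (Suc t) i = (j, i) # (j + h, y i) # (j, Suc i) # (j + h, y (Suc i)) # us"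
      using 3(1) i by (simp add: zz us_def del: zigzag.simps(2))
    have chain: "radio_chain path_star_dist L K s ((j, Suc i) # (j + h, y (Suc i)) # us)"
      using IH 3(1) i by (simp add: zz us_def del: zigzag.simps(2) path_star_dist_simp split: if_splits)
    have hd: "us = [] \<or> hd us = (k, 0)"
      using 3 y k by (simp add: us_def zz zk del: zigzag.simps(2) split: if_splits)
    show ?thesis
      unfolding eq
      by (rule radio_chain_Cons2I[OF chain _ _ _ _ _ hd];
          intro edge gap2_path_star gap3_path_star rj rk; use y h K k in simp)
  next
    case 4
    have y: "y i \<noteq> i" using "2.prems"(2) 4 by simp
    have eq: "zigzag e h y n (Suc t) i = [(j, i), (j + h, y i)]"
      by (subst zz) (use 4 in simp)
    show ?thesis
      unfolding eq radio_chain.simps by (intro edge rj) (use y in simp)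
  next
    case (5 t')
    have y: "y i \<noteq> i" "y i = 0" "y 0 \<noteq> 0" "0 < n" "0 < i"
      using "2.prems"(1,2,4) 5 by auto
    define k where "k = e + Suc t'"
    have k: "e < k" "k < h" "j = Suc k" "t = Suc t'" using 5 j by (auto simp: k_def)
    have zk: "zigzag e h y n (Suc t') i = (k, i) # (k + h, y i) #
        (if i < n then zigzag e h y n (Suc t') (Suc i) else zigzag e h y n t' 0)" for i
      by (simp add: k_def)
    have rk: "\<bar>int k - int (k + h)\<bar> = \<rho> k + \<rho> (k + h) + s" "\<bar>int (k + h) - int k\<bar> = \<rho> (k + h) + \<rho> k + s"
      "\<bar>int (j + h) - int k\<bar> = \<rho> (j + h) + \<rho> k + s"
      using "2.prems"(6)[of k] "2.prems"(7)[of k] k by simp_all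
    define us where "us = zigzag e h y n t (Suc 0)"
    have next_block: "zigzag e h y n t 0 = (k, 0) # (k + h, y 0) # us"
      using y(4) by (simp add: k(4) zk us_def del: zigzag.simps(2))
    have eq: "zigzag e h y n (Suc t) i = (j, i) # (j + h, y i) # (k, 0) # (k + h, y 0) # us"
      by (subst zz) (simp add: 5(1) next_block del: zigzag.simps(2))
    have chain: "radio_chain path_star_dist L K s ((k, 0) # (k + h, y 0) # us)"
      using IH by (simp only: 5(1) next_block less_irrefl if_False)
    have hd: "us = [] \<or> hd us = (k, Suc 0)"
      using y(4) by (simp add: us_def k(4) zk del: zigzag.simps(2))
    show ?thesis
      unfolding eq
      by (rule radio_chain_Cons2I[OF chain _ _ _ _ _ hd];
          intro edge gap2_path_star gap3_path_star rj rk; use y h K k in simp)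
  qed
qed

lemma set_zigzag:
  assumes y: "y ` {..n} = {..n}"
  shows "set (zigzag e h y n t 0) = ({e + 1..e + t} \<union> {e + h + 1..e + h + t}) \<times> {..n}"
proof -
  have block: "set (zigzag e h y n (Suc t) i) =
      {e + Suc t} \<times> {i..n} \<union> {e + Suc t + h} \<times> y ` {i..n} \<union> set (zigzag e h y n t 0)" if "i \<le> n" for t i
    using that
  proof (induction i rule: inc_induct)
    case base
    show ?case by (simp add: insert_commute)
  next
    case (step i)
    have "{i..n} = insert i {Suc i..n}" using step.hyps by auto
    moreover have "set (zigzag e h y n (Suc t) i) =
        insert (e + Suc t, i) (insert (e + Suc t + h, y i) (set (zigzag e h y n (Suc t) (Suc i))))"
      using step.hyps by (subst zigzag.simps(2)) (simp del: zigzag.simps(2))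
    ultimately show ?case unfolding step.IH by auto
  qed
  show ?thesis
  proof (induction t)
    case (Suc t)
    have "{e + 1..e + Suc t} = insert (e + Suc t) {e + 1..e + t}"
      "{e + h + 1..e + h + Suc t} = insert (e + Suc t + h) {e + h + 1..e + h + t}"
      by auto
    then show ?case
      unfolding block[OF le0] atLeast0AtMost y Suc.IH by blast
  qed simp
qed

lemma length_zigzag: "length (zigzag e h y n t 0) = 2 * (n + 1) * t"
proof -
  have block: "length (zigzag e h y n (Suc t) i) = 2 * (n + 1 - i) + length (zigzag e h y n t 0)"
    if "i \<le> n" for t i
    using that
  proof (induction i rule: inc_induct)
    case (step i)
    then show ?case
      by (subst zigzag.simps(2)) (simp add: Suc_diff_le del: zigzag.simps(2))
  qed simp
  show ?thesis
    by (induction t) (simp_all add: block del: zigzag.simps(2))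
qed

lemma last_zigzag:
  "0 < t \<Longrightarrow> i \<le> n \<Longrightarrow> zigzag e h y n t i \<noteq> [] \<and> last (zigzag e h y n t i) = (e + 1 + h, y n)"
proof (induction e h y n t i rule: zigzag.induct)
  case (2 e h y n t i)
  show ?case
  proof (cases "i < n")
    case True
    then show ?thesis using 2 by (simp del: One_nat_def)
  next
    case False
    then show ?thesis using 2 by (cases "t = 0") simp_all
  qed
qed simp

section \<open>Permutations of the star and sums of levels\<close>

text \<open>This is \<open>i + 2\<close> modulo \<open>n + 1\<close> with the last two values
  exchanged, so that \<open>n\<close> goes to 0. For \<open>n \<ge> 3\<close> it avoids
  \<open>i\<close> and \<open>i + 1\<close>.\<close>

definition shift2 :: "nat \<Rightarrow> nat \<Rightarrow> nat" where
  "shift2 n i = (if i = n then 0 else if i = n - 1 then 1 else i + 2)"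

text \<open>This is \<open>i + 3\<close> modulo \<open>n + 1\<close> with the last two values
  exchanged, which avoids a clash with \<open>shift2\<close> at \<open>n - 1\<close>. For
  \<open>n \<ge> 4\<close> it also avoids \<open>i\<close> and \<open>i + 1\<close>; for
  \<open>n = 3\<close> it would fix 2.\<close>

definition shift3 :: "nat \<Rightarrow> nat \<Rightarrow> nat" where
  "shift3 n i = (if i = n then 1 else if i = n - 1 then 2 else if i = n - 2 then 0 else i + 3)"

lemma inj_on_shift2: "inj_on (shift2 n) {..n}"
proof (rule inj_onI)
  fix i j assume "i \<in> {..n}" "j \<in> {..n}" "shift2 n i = shift2 n j"
  then show "i = j"
    unfolding shift2_def by (simp only: atMost_iff split: if_split_asm; linarith)
qed

lemma image_shift2:
  assumes "1 \<le> n"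
  shows "shift2 n ` {..n} = {..n}"
proof (rule endo_inj_surj[OF _ _ inj_on_shift2])
  show "shift2 n ` {..n} \<subseteq> {..n}"
    using assms unfolding shift2_def by (auto split: if_split_asm)
qed simp

lemma image_shift3:
  assumes "2 \<le> n"
  shows "shift3 n ` {..n} = {..n}"
proof (rule endo_inj_surj)
  show "shift3 n ` {..n} \<subseteq> {..n}"
    using assms unfolding shift3_def by (auto split: if_split_asm)
  show "inj_on (shift3 n) {..n}"
  proof (rule inj_onI)
    fix i j assume "i \<in> {..n}" "j \<in> {..n}" "shift3 n i = shift3 n j"
    then show "i = j"
      unfolding shift3_def by (simp only: atMost_iff split: if_split_asm; linarith)
  qed
qed simp

definition even_level :: "nat \<Rightarrow> nat \<Rightarrow> int" where
  "even_level h i = (if i \<le> h then int h - int i else int i - int h - 1)"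

definition odd_level :: "nat \<Rightarrow> nat \<Rightarrow> int" where
  "odd_level h i = \<bar>int i - (int h + 1)\<bar>"

definition vertex_level :: "(nat \<Rightarrow> int) \<Rightarrow> nat \<times> nat \<Rightarrow> int" where
  "vertex_level \<rho> v = \<rho> (fst v) + star_level (snd v)"

lemma vertex_level_simp [simp]: "vertex_level \<rho> (i, a) = \<rho> i + star_level a"
  by (simp add: vertex_level_def)

lemma sum_vertex_level:
  "(\<Sum>v\<in>{1..m} \<times> {0..n}. vertex_level \<rho> v) = (int n + 1) * (\<Sum>i=1..m. \<rho> i) + int m * int n"
proof -
  have "(\<Sum>v\<in>{1..m} \<times> {0..n}. vertex_level \<rho> v) = (\<Sum>i=1..m. \<Sum>a=0..n. \<rho> i + star_level a)"
    by (subst sum.cartesian_product) (simp add: vertex_level_def case_prod_beta)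
  moreover have "(\<Sum>a=0..n. star_level a) = int n"
    by (induction n) (simp_all add: star_level_def)
  ultimately show ?thesis
    by (simp add: sum.distrib sum_distrib_left algebra_simps)
qed

lemma sum_levels_below: "2 * (\<Sum>i=1..h. int c - int i) = int h * (2 * int c - int h - 1)"
  by (induction h) (simp_all add: algebra_simps)

lemma sum_levels_above: "2 * (\<Sum>i=h + 1..h + k. int i - int h - 1) = int k * (int k - 1)"
  by (induction k) (simp_all add: algebra_simps)

lemma sum_even_level: "(\<Sum>i=1..2 * h. even_level h i) = int h * (int h - 1)"
proof -
  have "(\<Sum>i=1..2 * h. even_level h i) = (\<Sum>i=1..h. even_level h i) + (\<Sum>i=h + 1..h + h. even_level h i)"
    using sum.ub_add_nat[of 1 h "even_level h" h] by (simp add: mult_2)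
  also have "\<dots> = (\<Sum>i=1..h. int h - int i) + (\<Sum>i=h + 1..h + h. int i - int h - 1)"
    by (intro arg_cong2[of _ _ _ _ "(+)"] sum.cong) (auto simp: even_level_def)
  finally show ?thesis using sum_levels_below[of h h] sum_levels_above[of h h] by (simp add: algebra_simps)
qed

lemma sum_odd_level: "(\<Sum>i=1..2 * h + 1. odd_level h i) = int h * (int h + 1)"
proof -
  have "(\<Sum>i=1..2 * h + 1. odd_level h i) = (\<Sum>i=1..h. odd_level h i) + (\<Sum>i=h + 1..h + (h + 1). odd_level h i)"
    using sum.ub_add_nat[of 1 h "odd_level h" "h + 1"] by (simp add: mult_2)
  also have "\<dots> = (\<Sum>i=1..h. int (h + 1) - int i) + (\<Sum>i=h + 1..h + (h + 1). int i - int h - 1)"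
    by (intro arg_cong2[of _ _ _ _ "(+)"] sum.cong) (auto simp: odd_level_def)
  finally show ?thesis using sum_levels_below[where c = "h + 1" and h = h] sum_levels_above[of h "h + 1"] by (simp add: algebra_simps)
qed

section \<open>From orderings to the radio number, and the case of even \<open>m\<close>\<close>

lemma radio_number_path_box_star_eqI:
  assumes "3 \<le> m" "3 \<le> n"
    and us: "set us = {1..m} \<times> {..n}" "length us = m * (n + 1)"
    and \<rho>: "\<And>i j. i \<in> {1..m} \<Longrightarrow> j \<in> {1..m} \<Longrightarrow> \<bar>int i - int j\<bar> \<le> \<rho> i + \<rho> j + s"
    and ends: "\<And>u v. u \<in> {1..m} \<times> {..n} \<Longrightarrow> v \<in> {1..m} \<times> {..n} \<Longrightarrow> u \<noteq> v \<Longrightarrow>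
      vertex_level \<rho> (hd us) + vertex_level \<rho> (last us) \<le> vertex_level \<rho> u + vertex_level \<rho> v"
    and chain: "radio_chain path_star_dist (vertex_level \<rho>) (int m + 2) s us"
  shows "int (radio_number (with_proj (box_product (path_graph m) (star_graph n)))) =
    (int m * (int n + 1) - 1) * (int m + 2 - s) - 2 * ((int n + 1) * (\<Sum>i=1..m. \<rho> i) + int m * int n)
    + vertex_level \<rho> (hd us) + vertex_level \<rho> (last us)"
proof -
  let ?G = "with_proj (box_product (path_graph m) (star_graph n))"
  have V: "verts ?G = {1..m} \<times> {..n}" unfolding verts_path_box_star by auto
  \<comment> \<open>Distinctness comes by counting: the list is as long as its set of entries is
    large.\<close>
  have dist: "distinct us"
    by (rule card_distinct) (simp add: us card_cartesian_product)
  have len: "2 \<le> length us"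
    using mult_le_mono[of 3 m 4 "n + 1"] assms(1,2) us(2) by simp
  have "int (radio_number ?G) = (int (length us) - 1) * ((int m + 2) - s)
      - 2 * (\<Sum>v\<in>verts ?G. vertex_level \<rho> v) + vertex_level \<rho> (hd us) + vertex_level \<rho> (last us)"
  proof (rule radio_number_eqI[OF _ dist len _ _ path_star_dist_commute path_star_dist_nonneg _ _ _ chain],
      unfold V)
    show "graph_dist ?G u v = real_of_int (path_star_dist u v)"
      if "u \<in> {1..m} \<times> {..n}" "v \<in> {1..m} \<times> {..n}" for u v
      using that by (intro graph_dist_path_box_star) auto
    show "diam ?G = real_of_int (int m + 2) - 1"
      using assms(1,2) by (simp add: diam_path_box_star)
    show "path_star_dist u v < int m + 2" if "u \<in> {1..m} \<times> {..n}" "v \<in> {1..m} \<times> {..n}" for u v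
      using that by (auto simp: star_dist_def)
    show "path_star_dist u v \<le> vertex_level \<rho> u + vertex_level \<rho> v + s"
      if "u \<in> {1..m} \<times> {..n}" "v \<in> {1..m} \<times> {..n}" for u v
      using \<rho>[of "fst u" "fst v"] star_dist_le[of "snd u" "snd v"] that
      by (auto simp: path_star_dist_def vertex_level_def)
  qed (use us(1) ends in auto)
  then show ?thesis
    unfolding verts_path_box_star sum_vertex_level us(2) by (simp add: algebra_simps)
qed

text \<open>The zigzag starts at \<open>(h, 0)\<close> and ends at \<open>(h + 1, 0)\<close>, both
  of level 0, so the end terms vanish. The offset \<open>s = 1\<close> stands for the edge between
  the two middle rows.\<close>

lemma radio_number_even:
  assumes h: "2 \<le> h" and n: "3 \<le> n"
  shows "int (radio_number (with_proj (box_product (path_graph (2 * h)) (star_graph n)))) =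
    (2 * int h * (int n + 1) - 1) * (2 * int h + 1)
    - 2 * ((int n + 1) * (int h * (int h - 1)) + 2 * int h * int n)"
proof -
  define us where "us = zigzag 0 h (shift2 n) n h 0"
  obtain t where t: "h = Suc t" using h by (cases h) auto
  have "hd us = (h, 0)" by (simp add: us_def t)
  moreover have "last us = (h + 1, 0)"
    using last_zigzag[of h 0 n 0 h "shift2 n"] h by (simp add: us_def shift2_def)
  ultimately have ends: "vertex_level (even_level h) (hd us) = 0" "vertex_level (even_level h) (last us) = 0"
    by (simp_all add: even_level_def star_level_def)
  have "int (radio_number (with_proj (box_product (path_graph (2 * h)) (star_graph n)))) =
    (int (2 * h) * (int n + 1) - 1) * (int (2 * h) + 2 - 1)
    - 2 * ((int n + 1) * (\<Sum>i=1..2 * h. even_level h i) + int (2 * h) * int n)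
    + vertex_level (even_level h) (hd us) + vertex_level (even_level h) (last us)"
  proof (rule radio_number_path_box_star_eqI)
    have "{1..h} \<union> {h + 1..h + h} = {1..2 * h}" by auto
    then show "set us = {1..2 * h} \<times> {..n}"
      using set_zigzag[OF image_shift2, of n 0 h h] n by (simp add: us_def)
    show "length us = 2 * h * (n + 1)" by (simp add: us_def length_zigzag)
    show "\<bar>int i - int j\<bar> \<le> even_level h i + even_level h j + 1" for i j
      by (auto simp: even_level_def)
    show "vertex_level (even_level h) (hd us) + vertex_level (even_level h) (last us)
        \<le> vertex_level (even_level h) u + vertex_level (even_level h) v" for u v
      unfolding ends by (auto simp: vertex_level_def even_level_def star_level_def)
    show "radio_chain path_star_dist (vertex_level (even_level h)) (int (2 * h) + 2) 1 us"
      unfolding us_def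
      by (rule radio_chain_zigzag[where \<rho> = "even_level h"])
        (use n in \<open>auto simp: shift2_def even_level_def inj_on_shift2\<close>)
  qed (use h n in auto)
  then show ?thesis unfolding ends sum_even_level by simp
qed

section \<open>The case of odd \<open>m\<close>\<close>

text \<open>Only \<open>(h + 1, 0)\<close> has level 0, so the end terms total at least 1. This is
  the final summand and the reason for the prescribed ends.\<close>

lemma radio_number_oddI:
  assumes h: "1 \<le> h" and n: "3 \<le> n"
    and us: "set us = {1..2 * h + 1} \<times> {..n}" "length us = (2 * h + 1) * (n + 1)"
    and ends: "hd us = (h + 1, 0)" "vertex_level (odd_level h) (last us) = 1"
    and chain: "radio_chain path_star_dist (vertex_level (odd_level h)) (2 * int h + 3) 0 us"
  shows "int (radio_number (with_proj (box_product (path_graph (2 * h + 1)) (star_graph n)))) =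
    ((2 * int h + 1) * (int n + 1) - 1) * (2 * int h + 3)
    - 2 * ((int n + 1) * (int h * (int h + 1)) + (2 * int h + 1) * int n) + 1"
proof -
  have level_hd: "vertex_level (odd_level h) (hd us) = 0"
    using ends(1) by (simp add: odd_level_def star_level_def)
  have "int (radio_number (with_proj (box_product (path_graph (2 * h + 1)) (star_graph n)))) =
    (int (2 * h + 1) * (int n + 1) - 1) * (int (2 * h + 1) + 2 - 0)
    - 2 * ((int n + 1) * (\<Sum>i=1..2 * h + 1. odd_level h i) + int (2 * h + 1) * int n)
    + vertex_level (odd_level h) (hd us) + vertex_level (odd_level h) (last us)"
  proof (rule radio_number_path_box_star_eqI[OF _ n us])
    show "\<bar>int i - int j\<bar> \<le> odd_level h i + odd_level h j + 0" for i j
      by (simp add: odd_level_def)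
    have "1 \<le> vertex_level (odd_level h) u" if "u \<noteq> (h + 1, 0)" for u
      using that by (cases u) (auto simp: odd_level_def star_level_def)
    moreover have "0 \<le> vertex_level (odd_level h) u" for u
      by (simp add: vertex_level_def odd_level_def star_level_def)
    ultimately show "vertex_level (odd_level h) (hd us) + vertex_level (odd_level h) (last us)
        \<le> vertex_level (odd_level h) u + vertex_level (odd_level h) v" if "u \<noteq> v" for u v
      unfolding level_hd ends(2) using that
      by (smt (verit) add_0)
    show "radio_chain path_star_dist (vertex_level (odd_level h)) (int (2 * h + 1) + 2) 0 us"
      using chain by (simp add: algebra_simps)
  qed (use h in auto)
  then show ?thesis unfolding level_hd ends(2) sum_odd_level by (simp add: algebra_simps)
qed

lemma radio_chain_zigzag_odd:
  assumes "1 \<le> n" "e + t \<le> h" and y: "\<And>i. i \<le> n \<Longrightarrow> y i \<noteq> i" "\<And>i. i < n \<Longrightarrow> y i \<noteq> Suc i" "y n = 0" "inj_on y {..n}"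
  shows "radio_chain path_star_dist (vertex_level (odd_level h)) (2 * int h + 3) 0 (zigzag e h y n t 0)"
proof (rule radio_chain_zigzag[where \<rho> = "odd_level h"])
qed (use assms in \<open>auto simp: odd_level_def\<close>)

text \<open>If \<open>a\<close> and \<open>c\<close> may agree, their star distance may vanish, so
  the full star contribution of up to 4 must be absorbed.\<close>

lemma gap2_path_star_weak:
  assumes "\<bar>int i - int j\<bar> + \<bar>int j - int k\<bar> + 4 \<le> K + \<bar>int i - int k\<bar>"
    "2 * (\<bar>int i - int j\<bar> + \<bar>int j - int k\<bar>) + 8 \<le> 3 * K"
  shows "gap2 path_star_dist K (i, a) (j, b) (k, c)"
proof -
  define x y z where "x = \<bar>int i - int j\<bar>" "y = \<bar>int j - int k\<bar>" "z = \<bar>int i - int k\<bar>"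
  then show ?thesis
    using assms star_dist_le[of a b] star_dist_le[of b c] star_dist_nonneg[of a c]
      star_level_bounds[of a] star_level_bounds[of b] star_level_bounds[of c]
    unfolding gap2_def path_star_dist_simp x_y_z_def[symmetric] by (simp del: star_dist_nonneg)
qed

text \<open>Passing through the star centre is no detour. This saving is needed where triples turn
  into the zigzag: rows 1, \<open>2 * h + 1\<close>, \<open>h\<close> give \<open>3 * h + 1\<close>
  against \<open>K + (h - 1) = 3 * h + 2\<close>, too tight for a slack of 2.\<close>

lemma gap2_path_star_centre:
  assumes "a \<noteq> c" "\<bar>int i - int j\<bar> + \<bar>int j - int k\<bar> \<le> K + \<bar>int i - int k\<bar>"
    "2 * (\<bar>int i - int j\<bar> + \<bar>int j - int k\<bar>) + 4 \<le> 3 * K"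
  shows "gap2 path_star_dist K (i, a) (j, 0) (k, c)"
  using assms unfolding gap2_def by (simp add: star_dist_def)

text \<open>The zigzag uses rows \<open>j\<close> and \<open>j + h\<close> for \<open>j\<close> from
  2 to \<open>h\<close>, which leaves these three. Their levels are 0, \<open>h\<close>,
  \<open>h\<close>, so the row distances \<open>h\<close>, \<open>2 * h\<close>, \<open>h\<close>
  around the cycle are tight.\<close>

fun triples :: "nat \<Rightarrow> (nat \<Rightarrow> nat) \<Rightarrow> (nat \<Rightarrow> nat) \<Rightarrow> nat list \<Rightarrow> (nat \<times> nat) list" where
  "triples h x y [] = []"
| "triples h x y (i # is) = (h + 1, i) # (1, x i) # (2 * h + 1, y i) # triples h x y is"

lemma radio_chain_triples:
  assumes "1 \<le> h" "1 \<le> n" "i \<le> n"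
    and x: "\<And>i. i \<le> n \<Longrightarrow> x i \<noteq> i" "\<And>i. i < n \<Longrightarrow> x i \<noteq> Suc i" "\<And>i. i \<le> n \<Longrightarrow> x i \<noteq> y i" "x n \<noteq> 0"
    and y: "\<And>i. i \<le> n \<Longrightarrow> y i \<noteq> i" "\<And>i. i < n \<Longrightarrow> y i \<noteq> Suc i" "y n = 0" "inj_on y {..n}"
  shows "radio_chain path_star_dist (vertex_level (odd_level h)) (2 * int h + 3) 0
    (triples h x y [i..<n + 1] @ zigzag 1 h y n (h - 1) 0)"
proof -
  have edge: "path_star_dist (i, a) (k, b) = vertex_level (odd_level h) (i, a) + vertex_level (odd_level h) (k, b) + 0"
    if "a \<noteq> b \<or> a = 0" "\<bar>int i - int k\<bar> = odd_level h i + odd_level h k" for i a k b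
    using that by (simp add: star_dist_eq)
  show ?thesis using assms(3)
  proof (induction i rule: inc_induct)
    case base
    have y0: "y 0 \<noteq> 0" using y(1)[of 0] by simp
    show ?case
    proof (cases "h = 1")
      case True
      then show ?thesis
        using assms(2) x(1)[of n] x(3,4) y(1)[of n] y(3)
        by (simp add: gap2_def star_dist_def star_level_def odd_level_def)
    next
      case False
      then obtain t where t: "h = Suc (Suc t)" using assms(1) by (metis One_nat_def not0_implies_Suc not_one_le_zero)
      define us where "us = zigzag 1 h y n (Suc t) 1"
      have zz: "zigzag 1 h y n (h - 1) 0 = (h, 0) # (2 * h, y 0) # us"
        and us: "us = (h, 1) # tl us"
        using assms(2) by (simp_all add: us_def t)
      \<comment> \<open>Windows starting in the last triple reach three vertices into the
        zigzag.\<close>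
      have zz': "zigzag 1 h y n (h - 1) 0 = (h, 0) # (2 * h, y 0) # (h, 1) # tl us"
        using zz us by simp
      have chain: "radio_chain path_star_dist (vertex_level (odd_level h)) (2 * int h + 3) 0 ((h, 0) # (2 * h, y 0) # (h, 1) # tl us)"
        using radio_chain_zigzag_odd[OF assms(2) _ y, of 1 "h - 1" h] assms(1) unfolding zz' by simp
      have eq: "triples h x y [n..<n + 1] @ zigzag 1 h y n (h - 1) 0 =
          (h + 1, n) # (1, x n) # (2 * h + 1, 0) # (h, 0) # (2 * h, y 0) # (h, 1) # tl us"
        unfolding zz' by (simp add: y(3))
      show ?thesis
        unfolding eq radio_chain.simps(1)
        by (intro conjI chain edge gap2_path_star_centre gap2_path_star gap3_path_star;
            use assms(2) x(1)[of n] x(4) y0 t in \<open>simp add: odd_level_def\<close>)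
    qed
  next
    case (step i)
    define us where "us = triples h x y [Suc (Suc i)..<n + 1] @ zigzag 1 h y n (h - 1) 0"
    have i: "i < n" "i < n + 1" "Suc i < n + 1" using step.hyps by simp_all
    have tail: "triples h x y [Suc i..<n + 1] @ zigzag 1 h y n (h - 1) 0 =
        (h + 1, Suc i) # (1, x (Suc i)) # (2 * h + 1, y (Suc i)) # us"
      using i by (simp only: us_def triples.simps append_Cons upt_conv_Cons[of "Suc i" "n + 1"])
    have eq: "triples h x y [i..<n + 1] @ zigzag 1 h y n (h - 1) 0 =
        (h + 1, i) # (1, x i) # (2 * h + 1, y i) # (h + 1, Suc i) # (1, x (Suc i)) # (2 * h + 1, y (Suc i)) # us"
      using i by (simp only: tail triples.simps append_Cons upt_conv_Cons[of i "n + 1"])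
    \<comment> \<open>Rows \<open>2 * h + 1\<close>, \<open>h + 1\<close>, 1 are monotone and leave
      a slack of 4, so \<open>y i\<close> and \<open>x (Suc i)\<close> may coincide.\<close>
    show ?case
      unfolding eq radio_chain.simps(1)
      by (intro conjI step.IH[unfolded tail] edge
            gap2_path_star_weak[of "2 * h + 1" "h + 1" 1] gap2_path_star gap3_path_star)
         (use assms(1) i x(1-3)[of i] x(1,3)[of "Suc i"] y(1,2)[of i] in \<open>simp_all add: odd_level_def\<close>)
  qed
qed

lemma set_triples:
  "set (triples h x y is) = {h + 1} \<times> set is \<union> {1} \<times> x ` set is \<union> {2 * h + 1} \<times> y ` set is"
  by (induction "is") auto

lemma length_triples: "length (triples h x y is) = 3 * length is"
  by (induction "is") auto

lemma last_triples: "is \<noteq> [] \<Longrightarrow> triples h x y is \<noteq> [] \<and> last (triples h x y is) = (2 * h + 1, y (last is))"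
proof (induction "is")
  case (Cons i "is")
  then show ?case by (cases "is = []") auto
qed simp

definition odd_order :: "nat \<Rightarrow> nat \<Rightarrow> (nat \<times> nat) list" where
  "odd_order h n = triples h (shift3 n) (shift2 n) [0..<n + 1] @ zigzag 1 h (shift2 n) n (h - 1) 0"

lemma radio_chain_odd_order:
  assumes "1 \<le> h" "4 \<le> n"
  shows "radio_chain path_star_dist (vertex_level (odd_level h)) (2 * int h + 3) 0 (odd_order h n)"
  unfolding odd_order_def
  by (rule radio_chain_triples) (use assms in \<open>auto simp: shift2_def shift3_def inj_on_shift2\<close>)

lemma set_odd_order:
  assumes "1 \<le> h" "4 \<le> n"
  shows "set (odd_order h n) = {1..2 * h + 1} \<times> {..n}"
proof -
  have "{1..2 * h + 1} = insert (h + 1) (insert 1 (insert (2 * h + 1) ({1 + 1..1 + (h - 1)} \<union> {1 + h + 1..1 + h + (h - 1)})))"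
    using assms(1) by auto
  moreover have "set [0..<n + 1] = {..n}" by auto
  moreover have "shift2 n ` {..n} = {..n}" "shift3 n ` {..n} = {..n}"
    using assms(2) by (simp_all add: image_shift2 image_shift3)
  ultimately show ?thesis
    unfolding odd_order_def set_append set_triples by (simp only: set_zigzag) blast
qed

lemma length_odd_order:
  assumes "1 \<le> h"
  shows "length (odd_order h n) = (2 * h + 1) * (n + 1)"
proof -
  obtain t where "h = Suc t" using assms by (cases h) auto
  then show ?thesis
    by (simp add: odd_order_def length_triples length_zigzag algebra_simps del: upt_Suc)
qed

lemma hd_odd_order: "hd (odd_order h n) = (h + 1, 0)"
  by (simp add: odd_order_def upt_conv_Cons del: upt_Suc)

text \<open>The last vertex is always \<open>(h + 2, 0)\<close>; for \<open>h = 1\<close> it ends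
  the last triple, as then \<open>2 * h + 1 = h + 2\<close>.\<close>

lemma last_odd_order:
  assumes "1 \<le> h"
  shows "vertex_level (odd_level h) (last (odd_order h n)) = 1"
proof (cases "h = 1")
  case True
  then show ?thesis
    using last_triples[of "[0..<n + 1]" h "shift3 n" "shift2 n"]
    by (simp add: odd_order_def shift2_def odd_level_def star_level_def)
next
  case False
  then show ?thesis
    using last_zigzag[of "h - 1" 0 n 1 h "shift2 n"] assms
    by (simp add: odd_order_def shift2_def odd_level_def star_level_def)
qed

section \<open>Odd \<open>m\<close> with \<open>n = 3\<close>\<close>

text \<open>
  For \<open>n = 3\<close> no permutation can play the role of \<open>shift3\<close>. The following prefixes were found by
  computer search; the one for \<open>h \<ge> 2\<close> uses the rows \<open>h\<close> and \<open>2 * h\<close> as well, since the rows 1,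
  \<open>h + 1\<close> and \<open>2 * h + 1\<close> alone did not give a prefix that works for all \<open>h\<close>.
\<close>

definition claw_order :: "nat \<Rightarrow> (nat \<times> nat) list" where
  "claw_order h = (if h = 1 then
    [(2, 0), (1, 1), (3, 2), (2, 3), (1, 2), (2, 1), (3, 3), (1, 0), (3, 1), (2, 2), (1, 3), (3, 0)]
   else
    [(h + 1, 0), (1, 1), (2 * h, 3), (h, 2), (2 * h + 1, 1),
     (h + 1, 3), (1, 2), (2 * h, 1), (h, 3), (2 * h + 1, 2),
     (h + 1, 1), (2 * h + 1, 3), (1, 0), (h + 1, 2), (1, 3),
     (2 * h + 1, 0), (h, 0), (2 * h, 2), (h, 1), (2 * h, 0)]
     @ zigzag 1 h (shift2 3) 3 (h - 2) 0)"

lemma radio_chain_claw_order: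
  assumes "1 \<le> h"
  shows "radio_chain path_star_dist (vertex_level (odd_level h)) (2 * int h + 3) 0 (claw_order h)"
proof -
  note defs = gap2_def gap3_def star_dist_def star_level_def odd_level_def
  consider "h = 1" | "h = 2" | t where "h = Suc (Suc (Suc t))"
    using assms by (metis One_nat_def Suc_1 not0_implies_Suc not_one_le_zero)
  then show ?thesis
  proof cases
    case 1
    then show ?thesis by (simp add: claw_order_def defs)
  next
    case 2
    then show ?thesis by (simp add: claw_order_def defs)
  next
    case (3 t)
    have h: "h \<noteq> 1" using 3 by simp
    define us where "us = tl (zigzag 1 h (shift2 3) 3 (Suc t) 1)"
    \<comment> \<open>The windows of the prefix see three zigzag vertices; with these exposed, all
      remaining conditions are linear in \<open>t\<close>.\<close>
    have zz: "zigzag 1 h (shift2 3) 3 (h - 2) 0 = (h - 1, 0) # (2 * h - 1, 2) # (h - 1, 1) # us"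
      by (simp add: 3 us_def shift2_def)
    have "radio_chain path_star_dist (vertex_level (odd_level h)) (2 * int h + 3) 0 (zigzag 1 h (shift2 3) 3 (h - 2) 0)"
      by (rule radio_chain_zigzag_odd) (use assms in \<open>auto simp: shift2_def inj_on_shift2\<close>)
    then have chain: "radio_chain path_star_dist (vertex_level (odd_level h)) (2 * int h + 3) 0
        ((h - 1, 0) # (2 * h - 1, 2) # (h - 1, 1) # us)"
      unfolding zz .
    have eq: "claw_order h = (h + 1, 0) # (1, 1) # (2 * h, 3) # (h, 2) # (2 * h + 1, 1) #
      (h + 1, 3) # (1, 2) # (2 * h, 1) # (h, 3) # (2 * h + 1, 2) #
      (h + 1, 1) # (2 * h + 1, 3) # (1, 0) # (h + 1, 2) # (1, 3) #
      (2 * h + 1, 0) # (h, 0) # (2 * h, 2) # (h, 1) # (2 * h, 0) #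
      (h - 1, 0) # (2 * h - 1, 2) # (h - 1, 1) # us"
      using h by (simp only: claw_order_def if_False zz append.simps)
    show ?thesis
      unfolding eq radio_chain.simps(1) by (intro conjI chain; simp add: 3 defs)
  qed
qed

lemma set_claw_order:
  assumes "1 \<le> h"
  shows "set (claw_order h) = {1..2 * h + 1} \<times> {..3}"
proof (cases "h = 1")
  case True
  have "{1..3} = {1, 2, 3 :: nat}" "{..3} = {0, 1, 2, 3 :: nat}" by auto
  then show ?thesis using True by (auto simp: claw_order_def)
next
  case False
  have rows: "{1..2 * h + 1} = {1, h, h + 1, 2 * h, 2 * h + 1} \<union>
      ({1 + 1..1 + (h - 2)} \<union> {1 + h + 1..1 + h + (h - 2)})"
    using assms False by auto
  have leaves: "{..3} = {0, 1, 2, 3 :: nat}" by auto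
  have Z: "set (zigzag 1 h (shift2 3) 3 (h - 2) 0) =
      ({1 + 1..1 + (h - 2)} \<union> {1 + h + 1..1 + h + (h - 2)}) \<times> {..3}"
    by (rule set_zigzag) (simp add: image_shift2)
  \<comment> \<open>With variables for the rows, the twenty pairs are matched without deciding which
    row numbers are equal.\<close>
  have prefix: "set [(c, 0), (a, 1), (d, 3), (b, 2), (e, 1),
     (c, 3), (a, 2), (d, 1), (b, 3), (e, 2),
     (c, 1), (e, 3), (a, 0), (c, 2), (a, 3),
     (e, 0), (b, 0), (d, 2), (b, 1), (d, 0)] =
      {a, b, c, d, e} \<times> {0, 1, 2, 3 :: nat}"
    (is "?S = ?A \<times> ?B") for a b c d e :: nat
  proof
    show "?S \<subseteq> ?A \<times> ?B" by simp
    have "\<forall>p\<in>?A. \<forall>q\<in>?B. (p, q) \<in> ?S" by simp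
    then show "?A \<times> ?B \<subseteq> ?S" by (simp only: subset_iff split_paired_All mem_Sigma_iff Ball_def imp_conjL all_simps)
  qed
  have "set (claw_order h) = {1, h, h + 1, 2 * h, 2 * h + 1} \<times> {..3} \<union>
      ({1 + 1..1 + (h - 2)} \<union> {1 + h + 1..1 + h + (h - 2)}) \<times> {..3}"
    using False by (simp only: claw_order_def if_False set_append Z leaves prefix)
  then show ?thesis unfolding rows by (simp only: Sigma_Un_distrib1)
qed

lemma length_claw_order:
  assumes "1 \<le> h"
  shows "length (claw_order h) = (2 * h + 1) * 4"
proof (cases "h = 1")
  case False
  then obtain t where "h = Suc (Suc t)" using assms by (metis One_nat_def not0_implies_Suc not_one_le_zero)
  then show ?thesis by (simp add: claw_order_def length_zigzag)
qed (simp add: claw_order_def)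

lemma hd_claw_order: "hd (claw_order h) = (h + 1, 0)"
  by (simp add: claw_order_def)

text \<open>Every case ends at \<open>(h + 2, 0)\<close>; for \<open>h = 2\<close> this is the final
  \<open>(2 * h, 0)\<close> of the prefix.\<close>

lemma last_claw_order:
  assumes "1 \<le> h"
  shows "vertex_level (odd_level h) (last (claw_order h)) = 1"
proof -
  consider "h = 1" | "h = 2" | "3 \<le> h" using assms by linarith
  then show ?thesis
  proof cases
    case 3
    then show ?thesis
      using last_zigzag[of "h - 2" 0 3 1 h "shift2 3"]
      by (simp add: claw_order_def shift2_def odd_level_def star_level_def)
  qed (simp_all add: claw_order_def odd_level_def star_level_def)
qed

section \<open>The odd radio number and the closed formulas\<close>

lemma radio_number_odd:
  assumes "1 \<le> h" "3 \<le> n"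
  shows "int (radio_number (with_proj (box_product (path_graph (2 * h + 1)) (star_graph n)))) =
    ((2 * int h + 1) * (int n + 1) - 1) * (2 * int h + 3)
    - 2 * ((int n + 1) * (int h * (int h + 1)) + (2 * int h + 1) * int n) + 1"
proof (cases "n = 3")
  case True
  have "length (claw_order h) = (2 * h + 1) * (3 + 1)"
    using length_claw_order[OF assms(1)] by simp
  from radio_number_oddI[OF assms(1) _ set_claw_order[OF assms(1)] this hd_claw_order
      last_claw_order[OF assms(1)] radio_chain_claw_order[OF assms(1)]]
  show ?thesis unfolding True by simp
next
  case False
  with assms(2) have "4 \<le> n" by simp
  with assms show ?thesis
    by (intro radio_number_oddI[where us = "odd_order h n"] set_odd_order length_odd_order
        hd_odd_order last_odd_order radio_chain_odd_order)
qed

theorem theorem4p2: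
  fixes m n :: nat
  assumes "m \<ge> 3" and "n \<ge> 3"
  shows "real (radio_number (with_proj (box_product (path_graph m) (star_graph n)))) =
    (if odd m
     then 1 / 2 * ((real m)\<^sup>2 * (real n + 1) + 2 * real m + real n - 1)
     else 1 / 2 * ((real m)\<^sup>2 * (real n + 1) + 2 * (real m - 1)))"
proof (cases "odd m")
  case True
  then obtain h where m: "m = 2 * h + 1" by (rule oddE)
  let ?r = "radio_number (with_proj (box_product (path_graph m) (star_graph n)))"
  have "real_of_int (int ?r) = real_of_int (((2 * int h + 1) * (int n + 1) - 1) * (2 * int h + 3)
      - 2 * ((int n + 1) * (int h * (int h + 1)) + (2 * int h + 1) * int n) + 1)"
    using radio_number_odd[of h n] assms unfolding m by simp
  then have "real ?r = ((2 * real h + 1) * (real n + 1) - 1) * (2 * real h + 3)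
      - 2 * ((real n + 1) * (real h * (real h + 1)) + (2 * real h + 1) * real n) + 1"
    by simp
  moreover have "real m = 2 * real h + 1" by (simp add: m)
  ultimately show ?thesis using True by (simp add: power2_eq_square algebra_simps)
next
  case False
  then obtain h where m: "m = 2 * h" by (auto elim: evenE)
  let ?r = "radio_number (with_proj (box_product (path_graph m) (star_graph n)))"
  have "real_of_int (int ?r) = real_of_int ((2 * int h * (int n + 1) - 1) * (2 * int h + 1)
      - 2 * ((int n + 1) * (int h * (int h - 1)) + 2 * int h * int n))"
    using radio_number_even[of h n] assms unfolding m by simp
  then have "real ?r = (2 * real h * (real n + 1) - 1) * (2 * real h + 1)
      - 2 * ((real n + 1) * (real h * (real h - 1)) + 2 * real h * real n)"
    by simp
  moreover have "real m = 2 * real h" by (simp add: m)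
  ultimately show ?thesis using False by (simp add: power2_eq_square algebra_simps)
qed

end
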